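(* Let $p>3$ be a prime and let $a$ be a positive integer. Then $$\sum_{k=0}^{p^a-1}\binom{2p^a-1}{k}\binom{2k}{k}(-1)^k\equiv\left(\frac{p^a}{3}\right)\left(2\times 3^{p-1}-1\right)\pmod{p^2}$$ and $$\sum_{k=0}^{p^a-1}\binom{p^a+k}{k}\frac{\binom{2k}{k}}{(-2)^k}\equiv\left(\frac{3}{p^a}\right)\bigl(1-p\,(q_p(2)+q_p(3))\bigr)\pmod{p^2}.$$
   Context: Congruences modulo $p^2$ between rational numbers with denominators prime to $p$ are taken in the ring $\mathbb{Z}_p$ of $p$-adic integers. $(-)$ denotes the Jacobi symbol. For $h\in\mathbb{Z}_p$ with $h\not\equiv0\pmod p$, $q_p(h)=(h^{p-1}-1)/p$ is the Fermat quotient. *)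

theory Defs
  imports "HOL-Number_Theory.Number_Theory"
begin

text \<open>
  The rationals with denominator prime to \<open>p\<close>, that is, the intersection of the rationals with
  the ring of \<open>p\<close>-adic integers.
\<close>

definition padic_integral :: "nat \<Rightarrow> rat \<Rightarrow> bool" where
  "padic_integral p x \<longleftrightarrow> \<not> int p dvd snd (quotient_of x)"

text \<open>
  The congruence modulo \<open>p ^ m\<close> in the ring of \<open>p\<close>-adic integers, restricted to rationals. The
  library's \<open>cong\<close> does not apply, since the modulus is invertible in \<^typ>\<open>rat\<close>.
  If \<open>x\<close> and \<open>y\<close> are rational, then so is \<open>(x - y) / p ^ m\<close>, hence it
  suffices to look for the cofactor among the rationals.
\<close>

definition padic_cong :: "nat \<Rightarrow> nat \<Rightarrow> rat \<Rightarrow> rat \<Rightarrow> bool" where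
  "padic_cong p m x y \<longleftrightarrow> padic_integral p x \<and> padic_integral p y \<and>
     (\<exists>z. padic_integral p z \<and> x - y = of_nat p ^ m * z)"

text \<open>The Jacobi symbol for odd \<open>n\<close>.\<close>

definition Jacobi :: "int \<Rightarrow> nat \<Rightarrow> int" where
  "Jacobi a n = (\<Prod>q\<in>#prime_factorization n. Legendre a (int q))"

definition fermat_quotient :: "nat \<Rightarrow> rat \<Rightarrow> rat" where
  "fermat_quotient p h = (h ^ (p - 1) - 1) / of_nat p"

end

theory Submission
  imports Defs "HOL-Computational_Algebra.Polynomial"
begin

text \<open>
  Let \<open>q = p ^ a = 2 * n + 1\<close> and \<open>c k = (- 1) ^ k * ((q - 1) choose k)\<close>. Modulo \<open>p\<^sup>2\<close> the number
  \<open>(- 1) ^ k * ((h * q - 1) choose k)\<close> depends affinely on \<open>h\<close>, hence equals \<open>1 - h + h * c k\<close>;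
  the cases \<open>h = 2\<close> and \<open>h = - 1\<close> occur here. This reduces everything to
  \<open>A0 = (\<Sum>k<q. ((2 * k) choose k) * M ^ (q - 1 - k))\<close> and
  \<open>A1 = (\<Sum>k<q. c k * ((2 * k) choose k) * M ^ (q - 1 - k))\<close> with \<open>h * M = 2\<close>.

  Put \<open>b = M - 2\<close>, \<open>D = M - 4\<close>, let \<open>u\<close> be the Lucas sequence of \<open>x\<^sup>2 - b * x + 1\<close>, and
  \<open>U = u (n + 1) + u n\<close>, \<open>V = u (n + 1) - u n\<close>, so that \<open>u q = U * V\<close> and \<open>M * V\<^sup>2 - D * U\<^sup>2 = 4\<close>.
  Modulo \<open>p\<^sup>2\<close>, \<open>A0 \<equiv> 2 * M ^ n * U - U * V\<close> because \<open>(2 * q) choose k \<equiv> 2 * (q choose k)\<close> for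
  \<open>0 < k < q\<close>, and \<open>A1 \<equiv> 2 * (M * D) ^ n - U * V\<close> because \<open>A1\<close> is the central coefficient of
  \<open>((x - \<alpha>) * (x - 1 / \<alpha>)) ^ (q - 1)\<close>, where \<open>\<alpha> + 1 / \<alpha> = b\<close>, and \<open>(c k)\<^sup>2 \<equiv> 2 * c k - 1\<close>.
  Modulo \<open>p\<close>, \<open>U \<equiv> D ^ n\<close> and \<open>V \<equiv> M ^ n\<close>. Linearising the quadratic relation between \<open>U\<close> and \<open>V\<close>
  at these signs shows that the Lucas quotients cancel in \<open>b * A0 + 2 * A1\<close>.
\<close>

section \<open>Lucas sequences and central binomial coefficients\<close>

fun lucas_u :: "int \<Rightarrow> nat \<Rightarrow> int" where
  "lucas_u b 0 = 0"
| "lucas_u b (Suc 0) = 1"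
| "lucas_u b (Suc (Suc n)) = b * lucas_u b (Suc n) - lucas_u b n"

text \<open>The recurrence preserves the norm form of \<open>x^2 - b * x + 1\<close>. Rewritten in
  sums and differences of neighbouring terms, this is \<open>M * V^2 - D * U^2 = 4\<close>.\<close>

lemma lucas_u_invariant:
  "(lucas_u b (Suc n))\<^sup>2 - b * lucas_u b (Suc n) * lucas_u b n + (lucas_u b n)\<^sup>2 = 1"
  by (induction n) (auto simp: power2_eq_square algebra_simps)

lemma lucas_u_add:
  "lucas_u b (m + Suc n) = lucas_u b (Suc m) * lucas_u b (Suc n) - lucas_u b m * lucas_u b n"
proof (induction b n rule: lucas_u.induct)
  case (3 b n)
  have "lucas_u b (m + Suc (Suc (Suc n))) = b * lucas_u b (m + Suc (Suc n)) - lucas_u b (m + Suc n)"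
    by simp
  then show ?case
    unfolding 3 by (simp add: algebra_simps)
qed auto

lemma lucas_u_odd:
  "lucas_u b (2 * n + 1) =
     (lucas_u b (Suc n) + lucas_u b n) * (lucas_u b (Suc n) - lucas_u b n)"
  using lucas_u_add[of b n n] by (simp add: mult_2 mult_2_right algebra_simps)

lemma lucas_u_uminus: "lucas_u (- b) (Suc n) = (- 1) ^ n * lucas_u b (Suc n)"
proof (induction b n rule: lucas_u.induct)
  case (3 b n)
  then show ?case
    by (subst (1 2) lucas_u.simps(3)) (simp add: algebra_simps del: lucas_u.simps)
qed auto

lemma sum_choose_Suc:
  fixes f :: "nat \<Rightarrow> int"
  shows "(\<Sum>k<Suc m. int (Suc N choose k) * f k) =
    (\<Sum>k<Suc m. int (N choose k) * f k) + (\<Sum>k<m. int (N choose k) * f (Suc k))"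
  by (simp add: sum.lessThan_Suc_shift sum.distrib algebra_simps del: sum.lessThan_Suc)

text \<open>Pascal's rule twice, with the index shifts moved onto \<open>f\<close>: for a Lucas-type
  \<open>f\<close> the bracket collapses to \<open>(b + 2) * f (Suc k)\<close>. The last two terms
  are the boundary left by truncating the sum.\<close>

lemma sum_choose_Suc_Suc:
  fixes f :: "nat \<Rightarrow> int"
  shows "(\<Sum>k<Suc (Suc m). int (Suc (Suc N) choose k) * f k) =
    (\<Sum>k<m. int (N choose k) * (f k + 2 * f (Suc k) + f (Suc (Suc k))))
    + int (N choose m) * (f m + 2 * f (Suc m)) + int (N choose Suc m) * f (Suc m)"
  unfolding sum_choose_Suc[of "Suc N"] sum_choose_Suc[of N]
  by (simp add: sum.distrib algebra_simps sum_distrib_left)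

text \<open>Both sides obey the same Horner recursion in \<open>N\<close>: multiply by
  \<open>b + 2\<close>, then add a central coefficient. On the right that coefficient is the
  boundary term, with weight \<open>lucas_u b 1 = 1\<close>.\<close>

lemma sum_central_choose_eq_sum_lucas:
  "(\<Sum>k<N. int ((2 * k) choose k) * (b + 2) ^ (N - 1 - k)) =
   (\<Sum>k<Suc N. int ((2 * N) choose k) * lucas_u b (N - k))"
proof (induction N)
  case (Suc N)
  have rec: "lucas_u b (Suc N - k) + 2 * lucas_u b (N - k) + lucas_u b (N - Suc k) =
      (b + 2) * lucas_u b (N - k)" if k: "k < N" for k
  proof -
    obtain j where "N = Suc (k + j)" using less_imp_Suc_add[OF k] by blast
    then have *: "Suc N - k = Suc (Suc j)" "N - k = Suc j" "N - Suc k = j" by auto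
    show ?thesis unfolding * by (simp add: algebra_simps)
  qed
  have "(\<Sum>k<Suc (Suc N). int ((2 * Suc N) choose k) * lucas_u b (Suc N - k)) =
      (\<Sum>k<N. int ((2 * N) choose k) *
        (lucas_u b (Suc N - k) + 2 * lucas_u b (N - k) + lucas_u b (N - Suc k)))
      + int ((2 * N) choose N)"
    using sum_choose_Suc_Suc[of "2 * N" "\<lambda>k. lucas_u b (Suc N - k)" N]
    by simp
  also have "\<dots> = (b + 2) * (\<Sum>k<Suc N. int ((2 * N) choose k) * lucas_u b (N - k))
      + int ((2 * N) choose N)"
    by (simp add: rec sum_distrib_left mult.left_commute)
  also have "\<dots> = (\<Sum>k<Suc N. int ((2 * k) choose k) * (b + 2) ^ (Suc N - 1 - k))"
  proof -
    have "(b + 2) ^ (N - k) = (b + 2) * (b + 2) ^ (N - Suc k)" if k: "k < N" for k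
      by (subst Suc_diff_Suc[OF k, symmetric]) (rule power_Suc)
    then show ?thesis
      unfolding Suc.IH[symmetric] by (simp add: sum_distrib_left mult.left_commute)
  qed
  finally show ?case by (rule sym)
qed auto

text \<open>A root \<open>x\<close> of \<open>x^2 - b * x + 1\<close> satisfies
  \<open>(1 + x)^2 = (b + 2) * x\<close>, so
  \<open>(1 + x)^(2 * n + 1) = (b + 2)^n * x^n * (1 + x)\<close>. The shift \<open>j\<close> is free
  because the induction step raises it by one.\<close>

lemma sum_choose_lucas_shift:
  "(\<Sum>k<2 * n + 2. int ((2 * n + 1) choose k) * lucas_u b (k + j)) =
     (b + 2) ^ n * (lucas_u b (Suc (n + j)) + lucas_u b (n + j))"
proof (induction n arbitrary: j)
  case 0
  have two: "2 * 0 + 2 = Suc (Suc 0)" by simp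
  show ?case unfolding two by simp
next
  case (Suc n)
  have "(\<Sum>k<2 * Suc n + 2. int ((2 * Suc n + 1) choose k) * lucas_u b (k + j)) =
    (\<Sum>k<Suc (Suc (2 * n + 2)). int (Suc (Suc (2 * n + 1)) choose k) * lucas_u b (k + j))"
  proof -
    have "2 * Suc n + 2 = Suc (Suc (2 * n + 2))" "2 * Suc n + 1 = Suc (Suc (2 * n + 1))" by auto
    then show ?thesis by (simp only:)
  qed
  also have "\<dots> =
    (\<Sum>k<2 * n + 2. int ((2 * n + 1) choose k) *
       (lucas_u b (k + j) + 2 * lucas_u b (Suc k + j) + lucas_u b (Suc (Suc k) + j)))"
    unfolding sum_choose_Suc_Suc by (simp add: binomial_eq_0 del: binomial_Suc_Suc sum.lessThan_Suc)
  also have "\<dots> = (b + 2) * (\<Sum>k<2 * n + 2. int ((2 * n + 1) choose k) * lucas_u b (k + Suc j))"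
    unfolding sum_distrib_left
    by (intro sum.cong) (auto simp: algebra_simps)
  also have "\<dots> = (b + 2) ^ Suc n * (lucas_u b (Suc (Suc n + j)) + lucas_u b (Suc n + j))"
    unfolding Suc by simp
  finally show ?case .
qed

lemma sum_choose_lucas:
  assumes "q = 2 * n + 1"
  shows "(\<Sum>k<Suc q. int (q choose k) * lucas_u b (q - k)) =
     (b + 2) ^ n * (lucas_u b (Suc n) + lucas_u b n)"
proof -
  have "(\<Sum>k<Suc q. int (q choose k) * lucas_u b (q - k)) =
      (\<Sum>k<Suc q. int (q choose k) * lucas_u b k)"
    by (subst sum.nat_diff_reindex[symmetric])
       (auto intro!: sum.cong simp: binomial_symmetric[symmetric] simp del: sum.lessThan_Suc)
  then show ?thesis
    using sum_choose_lucas_shift[of n b 0] assms by simp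
qed

text \<open>When \<open>2 * n + 1\<close> is a power of \<open>p\<close>, only the term
  \<open>k = 0\<close> survives modulo \<open>p\<close>, and its Lucas factor is
  \<open>V\<close>.\<close>

lemma power_eq_sum_choose_lucas:
  "(b + 2) ^ n =
     (\<Sum>k<Suc n. int ((2 * n + 1) choose k) * (lucas_u b (Suc (n - k)) - lucas_u b (n - k)))"
proof (induction n)
  case (Suc n)
  define f where "f k = lucas_u b (Suc k) - lucas_u b k" for k
  have rec: "f (Suc n - k) + 2 * f (n - k) + f (n - Suc k) = (b + 2) * f (n - k)"
    if k: "k < n" for k
  proof -
    obtain j where "n = Suc (k + j)" using less_imp_Suc_add[OF k] by blast
    then have *: "Suc n - k = Suc (Suc j)" "n - k = Suc j" "n - Suc k = j" by auto
    show ?thesis unfolding * by (simp add: f_def algebra_simps)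
  qed
  \<comment> \<open>The two middle entries of an odd row agree, so the boundary terms merge into one
    with factor \<open>(b - 1) + 2 + 1 = b + 2\<close>.\<close>
  have binom: "2 * n + 1 choose Suc n = (2 * n + 1 choose n)"
    using binomial_symmetric[of n "2 * n + 1"] by simp
  have f: "f 0 = 1" "f (Suc 0) = b - 1" and odd: "2 * Suc n + 1 = Suc (Suc (2 * n + 1))"
    by (auto simp: f_def)
  have "(\<Sum>k<Suc (Suc n). int ((2 * Suc n + 1) choose k) * f (Suc n - k)) =
      (\<Sum>k<n. int ((2 * n + 1) choose k) *
        (f (Suc n - k) + 2 * f (n - k) + f (n - Suc k)))
      + int ((2 * n + 1) choose n) * (b + 2)"
    unfolding odd sum_choose_Suc_Suc binom by (simp add: f ring_distribs del: binomial_Suc_Suc)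
  also have "\<dots> = (b + 2) * (\<Sum>k<Suc n. int ((2 * n + 1) choose k) * f (n - k))"
    by (simp add: rec sum_distrib_left f mult.left_commute distrib_left[of "b + 2"] del: binomial_Suc_Suc)
  finally show ?case using Suc by (simp add: f_def)
qed auto

text \<open>Two readings of the coefficient of \<open>x^N\<close> in
  \<open>((1 + x)^2 - m * x)^N = ((x - \<beta>) * (x - \<alpha>))^N\<close>: a binomial expansion on
  the left, a convolution on the right.\<close>

lemma sum_choose_central_eq_sum_choose_square:
  fixes \<alpha> \<beta> m :: "'a :: comm_ring_1"
  assumes "\<alpha> * \<beta> = 1" and "\<alpha> + \<beta> + 2 = m"
  shows "(\<Sum>k\<le>N. of_nat (N choose k) * of_nat ((2 * k) choose k) * (- m) ^ (N - k)) =
    (- 1) ^ N * (\<Sum>k\<le>N. of_nat (N choose k) ^ 2 * \<alpha> ^ k * \<beta> ^ (N - k))"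
proof -
  have "[:1, 1:] ^ 2 + monom (- m) 1 = [:- \<beta>, 1:] * [:- \<alpha>, 1:]"
    using assms by (auto simp: power2_eq_square monom_Suc monom_0 algebra_simps)
  then have "coeff (([:1, 1:] ^ 2 + monom (- m) 1) ^ N) N =
      coeff ([:- \<beta>, 1:] ^ N * [:- \<alpha>, 1:] ^ N) N"
    by (simp only: power_mult_distrib)
  moreover have "coeff (([:1, 1:] ^ 2 + monom (- m) 1) ^ N) N =
      (\<Sum>k\<le>N. of_nat (N choose k) * of_nat ((2 * k) choose k) * (- m) ^ (N - k))"
  proof -
    have "coeff (of_nat (N choose k) * ([:1, 1:] ^ 2) ^ k * monom (- m) 1 ^ (N - k)) N =
        of_nat (N choose k) * of_nat ((2 * k) choose k) * (- m) ^ (N - k)" if "k \<le> N" for k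
      using that by (simp add: power_mult[symmetric] monom_power coeff_monom_mult
          mult.commute[of _ "monom _ _"] coeff_linear_poly_power of_nat_poly mult.assoc)
    then show ?thesis
      by (simp add: binomial_ring coeff_sum)
  qed
  moreover have "coeff ([:- \<beta>, 1:] ^ N * [:- \<alpha>, 1:] ^ N) N =
      (- 1) ^ N * (\<Sum>k\<le>N. of_nat (N choose k) ^ 2 * \<alpha> ^ k * \<beta> ^ (N - k))"
    unfolding coeff_mult sum_distrib_left
  proof (intro sum.cong refl)
    fix k assume "k \<in> {..N}"
    then have k: "k \<le> N" by simp
    have "(- \<beta>) ^ (N - k) * (- \<alpha>) ^ k = (- 1) ^ (N - k + k) * (\<alpha> ^ k * \<beta> ^ (N - k))"
      unfolding power_add power_minus[of \<alpha>] power_minus[of \<beta>] by (simp add: mult_ac)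
    then show "coeff ([:- \<beta>, 1:] ^ N) k * coeff ([:- \<alpha>, 1:] ^ N) (N - k) =
        (- 1) ^ N * (of_nat (N choose k) ^ 2 * \<alpha> ^ k * \<beta> ^ (N - k))"
      using k by (simp add: coeff_linear_poly_power power2_eq_square mult_ac
          binomial_symmetric[symmetric])
  qed
  ultimately show ?thesis by simp
qed

text \<open>A division-free form of
  \<open>(\<alpha>^(N + 1) - \<beta>^(N + 1)) / (\<alpha> - \<beta>)\<close>, so a double root is
  covered too.\<close>

lemma sum_power_eq_lucas:
  fixes \<alpha> \<beta> :: "'a :: comm_ring_1"
  assumes "\<alpha> * \<beta> = 1" and "\<alpha> + \<beta> = of_int b"
  shows "(\<Sum>k\<le>N. \<alpha> ^ k * \<beta> ^ (N - k)) = of_int (lucas_u b (Suc N))"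
proof -
  define s where "s N = (\<Sum>k\<le>N. \<alpha> ^ k * \<beta> ^ (N - k))" for N
  have step: "s (Suc N) = \<alpha> ^ Suc N + \<beta> * s N" for N
  proof -
    have "\<beta> ^ (Suc N - k) = \<beta> * \<beta> ^ (N - k)" if "k \<le> N" for k
      using that by (simp add: Suc_diff_le)
    then show ?thesis
      by (simp add: s_def sum_distrib_left mult.left_commute add.commute)
  qed
  have "s N = of_int (lucas_u b (Suc N))"
  proof (induction N rule: induct_nat_012)
    case 1
    show ?case using assms(2) by (simp add: s_def add.commute)
  next
    case (ge2 N)
    have "s (Suc (Suc N)) = (\<alpha> + \<beta>) * s (Suc N) - \<alpha> * \<beta> * s N"
      using step[of N] step[of "Suc N"] by (simp add: algebra_simps)
    then show ?case using ge2 assms by simp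
  qed (simp add: s_def)
  then show ?thesis by (simp add: s_def)
qed

text \<open>Peeling off the two outermost terms leaves \<open>\<alpha> * \<beta> = 1\<close> times a
  shorter symmetric sum. This lets a congruence between symmetric coefficients pass to the sums as a
  congruence between integers.\<close>

lemma sum_symmetric_in_Ints:
  fixes \<alpha> \<beta> :: "'a :: comm_ring_1" and e :: "nat \<Rightarrow> int"
  assumes "\<alpha> * \<beta> = 1" and "\<alpha> + \<beta> = of_int b"
    and "\<And>k. k \<le> N \<Longrightarrow> e (N - k) = e k"
  shows "(\<Sum>k\<le>N. of_int (e k) * (\<alpha> ^ k * \<beta> ^ (N - k))) \<in> \<int>"
  using assms(3)
proof (induction N arbitrary: e rule: induct_nat_012)
  case (1 e)
  have "(\<Sum>k\<le>Suc 0. of_int (e k) * (\<alpha> ^ k * \<beta> ^ (Suc 0 - k))) = of_int (e 0) * (\<alpha> + \<beta>)"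
    using 1[of 0] by (simp add: algebra_simps)
  then show ?case using assms(2) by simp
next
  case (ge2 N e)
  have split: "(\<Sum>k\<le>Suc (Suc N). f k) = f 0 + f (Suc (Suc N)) + (\<Sum>k\<le>N. f (Suc k))"
    for f :: "nat \<Rightarrow> 'a"
    by (subst sum.atMost_Suc, subst sum.atMost_Suc_shift) simp
  have pow: "\<alpha> ^ Suc k * \<beta> ^ (Suc N - k) = \<alpha> ^ k * \<beta> ^ (N - k)" if "k \<le> N" for k
  proof -
    have "\<alpha> ^ Suc k * \<beta> ^ (Suc N - k) = (\<alpha> * \<beta>) * (\<alpha> ^ k * \<beta> ^ (N - k))"
      using that by (simp add: Suc_diff_le mult_ac)
    then show ?thesis using assms(1) by simp
  qed
  \<comment> \<open>The sum of all products of total degree \<open>N + 2\<close> minus the one of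
    degree \<open>N\<close> leaves just the two pure powers.\<close>
  have "\<alpha> ^ Suc (Suc N) + \<beta> ^ Suc (Suc N) =
      of_int (lucas_u b (Suc (Suc (Suc N))) - lucas_u b (Suc N))"
    unfolding of_int_diff sum_power_eq_lucas[OF assms(1,2), symmetric] split
    by (simp add: pow del: power_Suc)
  moreover have "e (Suc N - k) = e (Suc k)" if "k \<le> N" for k
    using ge2.prems[of "Suc k"] that by simp
  then have "e (Suc (N - k)) = e (Suc k)" if "k \<le> N" for k
    using that by (simp add: Suc_diff_le)
  then have "(\<Sum>k\<le>N. of_int (e (Suc k)) * (\<alpha> ^ k * \<beta> ^ (N - k))) \<in> \<int>"
    by (intro ge2.IH(1)) (simp add: Suc_diff_le)
  moreover have "(\<Sum>k\<le>Suc (Suc N). of_int (e k) * (\<alpha> ^ k * \<beta> ^ (Suc (Suc N) - k))) =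
     of_int (e 0) * (\<alpha> ^ Suc (Suc N) + \<beta> ^ Suc (Suc N)) +
     (\<Sum>k\<le>N. of_int (e (Suc k)) * (\<alpha> ^ k * \<beta> ^ (N - k)))"
    unfolding split using ge2.prems[of 0] by (simp add: pow algebra_simps del: power_Suc)
  ultimately show ?case by simp
qed auto

text \<open>The hypothesis linearises the squared binomials: the linear part sums to
  \<open>2 * (\<beta> - \<alpha>)^(2 * n)\<close> with
  \<open>(\<beta> - \<alpha>)^2 = b^2 - 4\<close>, the constant part to a Lucas number.\<close>

lemma sum_choose_central_cong:
  fixes b m :: int
  assumes "\<And>k. k \<le> 2 * n \<Longrightarrow> [int ((2 * n) choose k) ^ 2 = 2 * ((- 1) ^ k * int ((2 * n) choose k)) - 1] (mod m)"
  shows "[(\<Sum>k\<le>2 * n. (- 1) ^ k * int ((2 * n) choose k) * int ((2 * k) choose k) * (b + 2) ^ (2 * n - k))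
     = 2 * ((b + 2) * (b - 2)) ^ n - lucas_u b (2 * n + 1)] (mod m)"
    (is "[?A = ?B] (mod m)")
proof -
  define r :: complex where "r = csqrt (of_int (b\<^sup>2 - 4))"
  have r: "r * r = of_int (b\<^sup>2 - 4)"
    by (metis r_def power2_csqrt power2_eq_square)
  define \<alpha> where "\<alpha> = (of_int b + r) / 2"
  define \<beta> where "\<beta> = (of_int b - r) / 2"
  have prod: "\<alpha> * \<beta> = 1" and sum: "\<alpha> + \<beta> = of_int b" and diff: "\<beta> - \<alpha> = - r"
    using r by (auto simp: \<alpha>_def \<beta>_def field_simps power2_eq_square)
  define c where "c k = (- 1) ^ k * int ((2 * n) choose k)" for k
  define e where "e k = (int ((2 * n) choose k) ^ 2 - (2 * c k - 1)) div m" for k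
  have e: "int ((2 * n) choose k) ^ 2 = 2 * c k - 1 + m * e k" if "k \<le> 2 * n" for k
    using assms[OF that] by (simp add: e_def c_def cong_iff_dvd_diff)
  \<comment> \<open>Since \<open>2 * n\<close> is even, \<open>k\<close> and
    \<open>2 * n - k\<close> have the same parity, so the sign in \<open>c\<close> respects the
    symmetry.\<close>
  have "e (2 * n - k) = e k" if "k \<le> 2 * n" for k
    using that by (simp add: e_def c_def binomial_symmetric[symmetric] uminus_power_if)
  then obtain z where z: "(\<Sum>k\<le>2 * n. of_int (e k) * (\<alpha> ^ k * \<beta> ^ (2 * n - k))) = of_int z"
    using sum_symmetric_in_Ints[OF prod sum] by (meson Ints_cases)
  have "(of_int ?A :: complex) =
     (\<Sum>k\<le>2 * n. of_nat ((2 * n) choose k) * of_nat ((2 * k) choose k) * (- of_int (b + 2)) ^ (2 * n - k))"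
    unfolding of_int_sum
    by (intro sum.cong) (auto simp: uminus_power_if simp del: minus_add_distrib)
  also have "\<dots> = (\<Sum>k\<le>2 * n. of_int (int ((2 * n) choose k) ^ 2) * (\<alpha> ^ k * \<beta> ^ (2 * n - k)))"
    using sum by (subst sum_choose_central_eq_sum_choose_square[OF prod]) (auto simp: mult_ac)
  also have "\<dots> = (\<Sum>k\<le>2 * n. 2 * (of_nat ((2 * n) choose k) * (- \<alpha>) ^ k * \<beta> ^ (2 * n - k))
      - \<alpha> ^ k * \<beta> ^ (2 * n - k) + of_int m * (of_int (e k) * (\<alpha> ^ k * \<beta> ^ (2 * n - k))))"
    by (intro sum.cong refl, subst e) (auto simp: c_def power_minus[of \<alpha>] algebra_simps)
  also have "\<dots> = 2 * (- \<alpha> + \<beta>) ^ (2 * n) - of_int (lucas_u b (2 * n + 1)) + of_int m * of_int z"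
    unfolding binomial_ring
    by (simp add: sum.distrib sum_subtractf sum_distrib_left[symmetric] z sum_power_eq_lucas[OF prod sum] del: lucas_u.simps)
  also have "- \<alpha> + \<beta> = - r" using diff by simp
  also have "(- r) ^ (2 * n) = of_int ((b + 2) * (b - 2)) ^ n"
  proof -
    have "(- r)\<^sup>2 = of_int ((b + 2) * (b - 2))"
      using r by (simp add: power2_eq_square algebra_simps)
    then show ?thesis by (simp only: power_mult)
  qed
  finally have "(of_int ?A :: complex) = of_int (?B + m * z)"
    by simp
  then have "?A = ?B + m * z"
    unfolding of_int_eq_iff .
  then show ?thesis by (simp add: cong_iff_dvd_diff)
qed

section \<open>Binomial coefficients of prime powers modulo the square of the prime\<close>

text \<open>
  A substitute for \<open>p\<close>-adic valuations: \<open>p ^ a / k\<close> has positive valuation for \<open>0 < k < p ^ a\<close>.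
\<close>

lemma prime_power_dvd_cancel:
  fixes p k a r :: nat and x y :: int
  assumes "prime p" and "0 < k" and "k < p ^ a" and "int k ^ r * x = int (p ^ a) ^ r * y"
  shows "int p ^ r dvd x"
proof -
  obtain i l where k: "k = p ^ i * l" and l: "\<not> p dvd l"
    using assms(1,2) multiplicity_decompose'[of k p] by (metis not_prime_unit gr_implies_not0)
  have "p ^ i \<le> k"
    using k assms(2) by simp
  then have "i < a"
    using assms(1,3) by (meson le_less_trans power_less_imp_less_exp prime_gt_1_nat)
  then have q: "p ^ a = p ^ i * (p * p ^ (a - i - 1))"
    by (metis Suc_diff_Suc diff_diff_left add.commute plus_1_eq_Suc power_Suc power_add le_add_diff_inverse less_imp_le)
  have "int (p ^ i) ^ r * (int l ^ r * x) = int (p ^ i) ^ r * (int p ^ r * (int (p ^ (a - i - 1)) ^ r * y))"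
    using assms(4) unfolding k q by (simp add: power_mult_distrib mult_ac)
  then have "int p ^ r dvd int l ^ r * x"
    using assms(1) prime_gt_0_nat by simp
  moreover have "coprime (int p ^ r) (int l ^ r)"
    using assms(1) l by (simp add: prime_imp_coprime)
  ultimately show ?thesis
    by (simp add: coprime_dvd_mult_right_iff)
qed

lemma prime_dvd_prime_power_choose:
  assumes "prime p" and "0 < k" and "k < p ^ a"
  shows "int p dvd int (p ^ a choose k)"
proof -
  have "int k ^ 1 * int (p ^ a choose k) = int (p ^ a) ^ 1 * int ((p ^ a - 1) choose (k - 1))"
    using times_binomial_minus1_eq[OF assms(2), of "p ^ a"]
    by (metis of_nat_mult power_one_right)
  from prime_power_dvd_cancel[OF assms this] show ?thesis by simp
qed

text \<open>A signed Pascal rule: consecutive values of \<open>c\<close> differ by a binomial of the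
  full row, which is divisible by \<open>p\<close> in the applications.\<close>

lemma minus_1_power_choose_Suc:
  assumes "0 < q"
  shows "(- 1) ^ Suc k * int ((q - 1) choose Suc k) =
    (- 1) ^ k * int ((q - 1) choose k) + (- 1) ^ Suc k * int (q choose Suc k)"
  using assms by (cases q) (auto simp: algebra_simps)

lemma choose_prime_power_minus_1_cong:
  assumes "prime p" and "k < p ^ a"
  shows "[(- 1) ^ k * int ((p ^ a - 1) choose k) = 1] (mod int p)"
  using assms(2)
proof (induction k)
  case (Suc k)
  have "[(- 1) ^ Suc k * int (p ^ a choose Suc k) = 0] (mod int p)"
    using prime_dvd_prime_power_choose[OF assms(1) _ Suc.prems] by (simp add: cong_0_iff)
  from cong_add[OF Suc.IH this] show ?case
    unfolding minus_1_power_choose_Suc[OF order.strict_trans1[OF le0 Suc.prems]]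
    using Suc.prems by simp
qed simp

lemma choose_prime_power_minus_1_square_cong:
  assumes "prime p" and "k < p ^ a"
  shows "[int ((p ^ a - 1) choose k) ^ 2 = 2 * ((- 1) ^ k * int ((p ^ a - 1) choose k)) - 1] (mod int p ^ 2)"
proof -
  have "int p ^ 2 dvd ((- 1) ^ k * int ((p ^ a - 1) choose k) - 1) ^ 2"
    using choose_prime_power_minus_1_cong[OF assms] by (simp add: cong_iff_dvd_diff)
  also have "((- 1) ^ k * int ((p ^ a - 1) choose k) - 1) ^ 2 =
      int ((p ^ a - 1) choose k) ^ 2 - (2 * ((- 1) ^ k * int ((p ^ a - 1) choose k)) - 1)"
    by (simp add: power2_diff power_mult_distrib power_mult[symmetric] mult.commute[of k])
  finally show ?thesis
    by (simp add: cong_iff_dvd_diff)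
qed

text \<open>In Vandermonde's convolution every inner term has two factors divisible by
  \<open>p\<close>; the two end terms remain.\<close>

lemma choose_twice_prime_power_cong:
  assumes "prime p" and "0 < k" and "k < p ^ a"
  shows "[int ((2 * p ^ a) choose k) = 2 * int (p ^ a choose k)] (mod int p ^ 2)"
proof -
  let ?q = "p ^ a"
  obtain j where j: "k = Suc j" using assms(2) gr0_implies_Suc by blast
  have "int ((2 * ?q) choose k) = (\<Sum>i\<le>Suc j. int (?q choose i) * int (?q choose (k - i)))"
    using vandermonde[of ?q ?q k] j by (simp add: mult_2 flip: of_nat_mult of_nat_sum del: binomial_Suc_Suc)
  also have "\<dots> = 2 * int (?q choose k) + (\<Sum>i<j. int (?q choose Suc i) * int (?q choose (k - Suc i)))"
    unfolding sum.atMost_Suc unfolding lessThan_Suc_atMost[symmetric] sum.lessThan_Suc_shift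
    using j by simp
  finally have "int ((2 * ?q) choose k) - 2 * int (?q choose k) =
      (\<Sum>i<j. int (?q choose Suc i) * int (?q choose (k - Suc i)))" by simp
  moreover have "int p ^ 2 dvd (\<Sum>i<j. int (?q choose Suc i) * int (?q choose (k - Suc i)))"
    unfolding power2_eq_square
    by (intro dvd_sum mult_dvd_mono prime_dvd_prime_power_choose[OF assms(1)]) (use assms j in auto)
  ultimately show ?thesis
    by (simp add: cong_iff_dvd_diff)
qed

text \<open>The case \<open>h = 2\<close>: the signed Pascal rules for \<open>q\<close> and
  \<open>2 * q\<close> run in parallel, with increments in ratio 2 modulo
  \<open>p^2\<close>.\<close>

lemma choose_twice_prime_power_minus_1_cong:
  assumes "prime p" and "k < p ^ a"
  shows "[(- 1) ^ k * int ((2 * p ^ a - 1) choose k) =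
     2 * ((- 1) ^ k * int ((p ^ a - 1) choose k)) - 1] (mod int p ^ 2)"
  using assms(2)
proof (induction k)
  case (Suc k)
  have "0 < p ^ a" "0 < 2 * p ^ a"
    using assms(1) prime_gt_0_nat by auto
  note rec = this[THEN minus_1_power_choose_Suc]
  have "[(- 1) ^ Suc k * int ((2 * p ^ a) choose Suc k) =
      (- 1) ^ Suc k * (2 * int (p ^ a choose Suc k))] (mod int p ^ 2)"
    by (intro cong_mult choose_twice_prime_power_cong[OF assms(1) _ Suc.prems] cong_refl) simp
  from cong_add[OF Suc.IH this] show ?case
    unfolding rec using Suc.prems by (simp add: algebra_simps)
qed simp

text \<open>The case \<open>h = - 1\<close>. Here \<open>f k\<close> and \<open>c k\<close> are the
  products of \<open>1 + q / i\<close> and \<open>1 - q / i\<close> for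
  \<open>1 \<le> i \<le> k\<close>, so they are inverse modulo \<open>p^2\<close>; as
  \<open>c k\<close> is 1 modulo \<open>p\<close>, its inverse is \<open>2 - c k\<close>.\<close>

lemma choose_prime_power_add_cong:
  assumes "prime p" and "k < p ^ a"
  shows "[int ((p ^ a + k) choose k) = 2 - (- 1) ^ k * int ((p ^ a - 1) choose k)] (mod int p ^ 2)"
proof -
  define q where "q = p ^ a"
  define f where "f k = int ((q + k) choose k)" for k
  define c where "c k = (- 1) ^ k * int ((q - 1) choose k)" for k
  have q: "0 < q" using assms by (simp add: q_def prime_gt_0_nat)
  have "[f k * c k = 1] (mod int p ^ 2)"
    using assms(2)
  proof (induction k)
    case (Suc k)
    have f: "int (Suc k) * f (Suc k) = (int q + int (Suc k)) * f k"
      using times_binomial_minus1_eq[of "Suc k" "q + Suc k"] unfolding f_def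
      by (simp flip: of_nat_mult of_nat_add add: algebra_simps del: binomial_Suc_Suc of_nat_Suc mult_Suc mult_Suc_right)
    have "int (Suc k) * int (q choose Suc k) = int q * int ((q - 1) choose k)"
      using times_binomial_minus1_eq[of "Suc k" q] by (simp flip: of_nat_mult del: of_nat_Suc)
    then have "int (Suc k) * c (Suc k) = int (Suc k) * c k + (- 1) ^ Suc k * (int q * int ((q - 1) choose k))"
      unfolding c_def minus_1_power_choose_Suc[OF q] distrib_left by (simp only: mult.left_commute[of _ "(- 1) ^ Suc k"])
    then have c: "int (Suc k) * c (Suc k) = (int (Suc k) - int q) * c k"
      by (simp add: c_def algebra_simps)
    \<comment> \<open>The new factor is \<open>1 - (q / (k + 1))^2\<close>, here with its
      denominator cleared.\<close>
    have "int (Suc k) ^ 2 * (f (Suc k) * c (Suc k) - f k * c k) = 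
       (int (Suc k) * f (Suc k)) * (int (Suc k) * c (Suc k)) - int (Suc k) ^ 2 * (f k * c k)"
      by (simp add: power2_eq_square algebra_simps)
    also have "\<dots> = int (p ^ a) ^ 2 * (- (f k * c k))"
      unfolding f c q_def by (simp add: power2_eq_square algebra_simps)
    finally have "int p ^ 2 dvd f (Suc k) * c (Suc k) - f k * c k"
      using prime_power_dvd_cancel[OF assms(1) _ Suc.prems] by blast
    then have "[f (Suc k) * c (Suc k) = f k * c k] (mod int p ^ 2)"
      by (simp add: cong_iff_dvd_diff)
    then show ?case using Suc cong_trans by (metis Suc_lessD)
  qed (simp add: f_def c_def)
  then have "[f k * c k * (2 - c k) + f k * (c k - 1) ^ 2 = 1 * (2 - c k) + f k * 0] (mod int p ^ 2)"
    using choose_prime_power_minus_1_cong[OF assms]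
    by (intro cong_add cong_mult cong_refl) (simp_all add: cong_iff_dvd_diff c_def q_def)
  moreover have "f k * c k * (2 - c k) + f k * (c k - 1) ^ 2 = f k"
    by (simp add: power2_eq_square algebra_simps)
  ultimately show ?thesis
    by (simp add: f_def c_def q_def)
qed

lemma sum_central_choose_cong:
  assumes "prime p" and "p ^ a = 2 * n + 1"
  shows "[(\<Sum>k<p ^ a. int ((2 * k) choose k) * (b + 2) ^ (p ^ a - 1 - k)) =
     2 * ((b + 2) ^ n * (lucas_u b (Suc n) + lucas_u b n)) - lucas_u b (p ^ a)] (mod int p ^ 2)"
proof -
  let ?q = "p ^ a" and ?u = "lucas_u b"
  \<comment> \<open>At \<open>k = 0\<close> the true coefficient is 1 instead of 2, hence the
    correction; at \<open>k = q\<close> the factor \<open>lucas_u b 0\<close> vanishes.\<close>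
  have "[(\<Sum>k<Suc ?q. int ((2 * ?q) choose k) * ?u (?q - k)) =
     (\<Sum>k<Suc ?q. 2 * (int (?q choose k) * ?u (?q - k)) - (if k = 0 then ?u ?q else 0))] (mod int p ^ 2)"
  proof (rule cong_sum)
    fix k assume "k \<in> {..<Suc ?q}"
    then consider "k = 0" | "k = ?q" | "0 < k" "k < ?q" by fastforce
    then show "[int ((2 * ?q) choose k) * ?u (?q - k) =
        2 * (int (?q choose k) * ?u (?q - k)) - (if k = 0 then ?u ?q else 0)] (mod int p ^ 2)"
    proof cases
      case 3
      then show ?thesis
        using cong_mult[OF choose_twice_prime_power_cong[OF assms(1) 3] cong_refl, of "?u (?q - k)"]
        by (simp add: mult.assoc)
    qed (use assms(2) in auto)
  qed
  also have "(\<Sum>k<Suc ?q. 2 * (int (?q choose k) * ?u (?q - k)) - (if k = 0 then ?u ?q else 0)) =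
     2 * (\<Sum>k<Suc ?q. int (?q choose k) * ?u (?q - k)) - ?u ?q"
    unfolding sum_subtractf sum_distrib_left[symmetric] by (simp del: sum.lessThan_Suc)
  also have "(\<Sum>k<Suc ?q. int (?q choose k) * ?u (?q - k)) = (b + 2) ^ n * (?u (Suc n) + ?u n)"
    by (rule sum_choose_lucas[OF assms(2)])
  finally show ?thesis
    unfolding sum_central_choose_eq_sum_lucas .
qed

lemma lucas_u_diff_cong:
  assumes "prime p" and "p ^ a = 2 * n + 1"
  shows "[lucas_u b (Suc n) - lucas_u b n = (b + 2) ^ n] (mod int p)"
proof -
  let ?f = "\<lambda>k. int ((2 * n + 1) choose k) * (lucas_u b (Suc (n - k)) - lucas_u b (n - k))"
  have "int p dvd ?f (Suc k)" if "k < n" for k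
    using prime_dvd_prime_power_choose[OF assms(1), of "Suc k" a] that assms(2)
    by (intro dvd_mult2) simp
  then have "int p dvd (\<Sum>k<n. ?f (Suc k))"
    by (intro dvd_sum) auto
  moreover have "(b + 2) ^ n = (lucas_u b (Suc n) - lucas_u b n) + (\<Sum>k<n. ?f (Suc k))"
    unfolding power_eq_sum_choose_lucas sum.lessThan_Suc_shift by simp
  ultimately show ?thesis
    by (simp add: cong_iff_dvd_diff)
qed

text \<open>Replacing \<open>b\<close> by \<open>- b\<close> exchanges \<open>U\<close> and
  \<open>V\<close> up to the sign \<open>(- 1)^n\<close>.\<close>

lemma lucas_u_add_cong:
  assumes "prime p" and "p ^ a = 2 * n + 1"
  shows "[lucas_u b (Suc n) + lucas_u b n = (b - 2) ^ n] (mod int p)"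
proof -
  have "lucas_u (- b) (Suc n) - lucas_u (- b) n = (- 1) ^ n * (lucas_u b (Suc n) + lucas_u b n)"
  proof (cases n)
    case (Suc m)
    then show ?thesis unfolding Suc lucas_u_uminus by (simp add: algebra_simps)
  qed simp
  moreover have "(- b + 2) ^ n = (- 1) ^ n * (b - 2) ^ n"
    by (simp flip: power_mult_distrib)
  ultimately have "[(- 1) ^ n * (lucas_u b (Suc n) + lucas_u b n) = (- 1) ^ n * (b - 2) ^ n] (mod int p)"
    using lucas_u_diff_cong[OF assms, of "- b"] by simp
  from cong_mult[OF cong_refl[of "(- 1) ^ n"] this] show ?thesis
    by (simp flip: mult.assoc power_mult_distrib)
qed

section \<open>Cancellation of the Lucas quotients\<close>

lemma cong_pm_1_obtain:
  fixes x \<delta> p :: int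
  assumes "\<delta> \<in> {1, - 1}" and "[x = \<delta>] (mod p)"
  obtains m where "x = \<delta> * (1 + p * m)"
proof -
  obtain z where z: "x - \<delta> = p * z"
    using assms(2) by (auto simp: cong_iff_dvd_diff)
  then have "x = \<delta> * (1 + p * (\<delta> * z))"
    using assms(1) by (auto simp: algebra_simps)
  then show thesis by (rule that)
qed

text \<open>With \<open>U = \<epsilon> * (1 + p * x)\<close> and
  \<open>V = \<delta> * (1 + p * y)\<close>, the unknowns enter to first order only through
  \<open>(2 * b - M) * x - M * y = D * x - M * y\<close>, which the norm relation makes divisible by
  \<open>p\<close>. This dictates the weights \<open>b\<close> and 2.\<close>

lemma combined_sum_cong:
  fixes b \<delta> \<epsilon> :: int
  assumes p: "prime p" "odd p" and q: "p ^ a = 2 * n + 1"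
    and \<delta>: "\<delta> \<in> {1, - 1}" "[(b + 2) ^ n = \<delta>] (mod int p)"
    and \<epsilon>: "\<epsilon> \<in> {1, - 1}" "[(b - 2) ^ n = \<epsilon>] (mod int p)"
  shows "[b * (\<Sum>k<p ^ a. int ((2 * k) choose k) * (b + 2) ^ (p ^ a - 1 - k)) +
      2 * (\<Sum>k<p ^ a. (- 1) ^ k * int ((p ^ a - 1) choose k) * int ((2 * k) choose k) * (b + 2) ^ (p ^ a - 1 - k))
      = \<delta> * \<epsilon> * ((b + 2) ^ (p ^ a - 1) * (b + 2) + 2 * ((b - 2) ^ (p ^ a - 1) - 1))] (mod int p ^ 2)"
    (is "[b * ?A0 + 2 * ?A1 = ?R] (mod _)")
proof -
  define U V where "U = lucas_u b (Suc n) + lucas_u b n" and "V = lucas_u b (Suc n) - lucas_u b n"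
  let ?p = "int p"
  have sq: "(\<delta> * z) * (\<delta> * z) = z * z" "(\<epsilon> * z) * (\<epsilon> * z) = z * z" for z
    using \<delta>(1) \<epsilon>(1) by auto
  obtain m where m: "(b + 2) ^ n = \<delta> * (1 + ?p * m)" using cong_pm_1_obtain[OF \<delta>] .
  obtain d where d: "(b - 2) ^ n = \<epsilon> * (1 + ?p * d)" using cong_pm_1_obtain[OF \<epsilon>] .
  obtain x where x: "U = \<epsilon> * (1 + ?p * x)"
    using cong_pm_1_obtain[OF \<epsilon>(1) cong_trans[OF lucas_u_add_cong[OF p(1) q] \<epsilon>(2)]] U_def by metis
  obtain y where y: "V = \<delta> * (1 + ?p * y)"
    using cong_pm_1_obtain[OF \<delta>(1) cong_trans[OF lucas_u_diff_cong[OF p(1) q] \<delta>(2)]] V_def by metis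
  have "(b + 2) * (V * V) - (b - 2) * (U * U) =
      4 * ((lucas_u b (Suc n))\<^sup>2 - b * lucas_u b (Suc n) * lucas_u b n + (lucas_u b n)\<^sup>2)"
    by (simp add: U_def V_def power2_eq_square algebra_simps)
  then have "(b + 2) * (V * V) - (b - 2) * (U * U) = 4"
    unfolding lucas_u_invariant by simp
  then have "(b + 2) * ((1 + ?p * y) * (1 + ?p * y)) - (b - 2) * ((1 + ?p * x) * (1 + ?p * x)) = 4"
    unfolding x y sq .
  \<comment> \<open>The constant terms cancel because \<open>(b + 2) - (b - 2) = 4\<close>, so one
    factor \<open>p\<close> can be divided out.\<close>
  then have "?p * (2 * ((b + 2) * y - (b - 2) * x)) = ?p * (?p * ((b - 2) * x * x - (b + 2) * y * y))"
    by (simp add: algebra_simps)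
  then have "?p dvd 2 * ((b + 2) * y - (b - 2) * x)"
    using p by (simp add: prime_gt_0_nat)
  then have "?p dvd (b + 2) * y - (b - 2) * x"
    using p by (metis coprime_dvd_mult_right_iff coprime_right_2_iff_odd even_of_nat)
  then obtain w where w: "(b + 2) * y - (b - 2) * x = ?p * w" by (elim dvdE)
  have u: "lucas_u b (p ^ a) = U * V"
    unfolding q lucas_u_odd U_def V_def ..
  have A0: "[?A0 = 2 * ((b + 2) ^ n * U) - U * V] (mod ?p ^ 2)"
    using sum_central_choose_cong[OF p(1) q, of b] by (simp only: u U_def)
  have "[?A1 = 2 * ((b + 2) * (b - 2)) ^ n - U * V] (mod ?p ^ 2)"
    using sum_choose_central_cong[of n "?p ^ 2" b] choose_prime_power_minus_1_square_cong[OF p(1), of _ a] u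
    unfolding q by (simp add: lessThan_Suc_atMost)
  then have "[b * ?A0 + 2 * ?A1 = b * (2 * ((b + 2) ^ n * U) - U * V)
     + 2 * (2 * ((b + 2) * (b - 2)) ^ n - U * V)] (mod ?p ^ 2)"
    by (intro cong_add cong_mult cong_refl A0)
  also have "b * (2 * ((b + 2) ^ n * U) - U * V) + 2 * (2 * ((b + 2) * (b - 2)) ^ n - U * V) =
     \<delta> * \<epsilon> * (2 * b * ((1 + ?p * m) * (1 + ?p * x)) - (b + 2) * ((1 + ?p * x) * (1 + ?p * y))
       + 4 * ((1 + ?p * m) * (1 + ?p * d)))"
    unfolding power_mult_distrib m d x y by (simp add: algebra_simps)
  also have "[\<dots> = ?R] (mod ?p ^ 2)"
  proof -
    have sq_pow: "z ^ (p ^ a - 1) = z ^ n * z ^ n" for z :: int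
      using q by (simp add: mult_2 flip: power_add)
    have R: "?R = \<delta> * \<epsilon> * ((1 + ?p * m) * (1 + ?p * m) * (b + 2) + 2 * ((1 + ?p * d) * (1 + ?p * d) - 1))"
      unfolding sq_pow m d sq ..
    have "2 * b * ((1 + ?p * m) * (1 + ?p * x)) - (b + 2) * ((1 + ?p * x) * (1 + ?p * y))
       + 4 * ((1 + ?p * m) * (1 + ?p * d)) -
       ((1 + ?p * m) * (1 + ?p * m) * (b + 2) + 2 * ((1 + ?p * d) * (1 + ?p * d) - 1)) =
       - ?p * ((b + 2) * y - (b - 2) * x) +
       ?p ^ 2 * (2 * b * m * x - (b + 2) * x * y + 4 * m * d - (b + 2) * m * m - 2 * d * d)"
      by (simp add: power2_eq_square algebra_simps)
    also have "\<dots> = ?p ^ 2 * (- w + 2 * b * m * x - (b + 2) * x * y + 4 * m * d - (b + 2) * m * m - 2 * d * d)"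
      unfolding w by (simp add: power2_eq_square algebra_simps)
    finally show ?thesis
      unfolding R by (intro cong_mult cong_refl) (simp add: cong_iff_dvd_diff)
  qed
  finally show ?thesis .
qed

section \<open>Euler's criterion and Fermat quotients at prime powers\<close>

lemma Legendre_pm_1:
  assumes "\<not> int p dvd h"
  shows "Legendre h (int p) \<in> {1, - 1}"
  using assms by (auto simp: Legendre_def cong_0_iff)

lemma Legendre_power_pm_1:
  assumes "\<not> int p dvd h"
  shows "Legendre h (int p) ^ a \<in> {1, - 1}"
  using Legendre_pm_1[OF assms] by (cases "even a") auto

text \<open>Induction from Euler's criterion: the half exponent for \<open>p ^ Suc a\<close> is
  \<open>r + n' * p\<close>, and an odd power \<open>p\<close> fixes a sign.\<close>

lemma power_half_prime_power_cong:
  assumes p: "prime p" "odd p" and h: "\<not> int p dvd h" and "p ^ a = 2 * n + 1"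
  shows "[h ^ n = Legendre h (int p) ^ a] (mod int p)"
  using assms(4)
proof (induction a arbitrary: n)
  case (Suc a)
  let ?L = "Legendre h (int p)"
  have "2 < p" using p prime_gt_1_nat by (metis One_nat_def Suc_lessI dvd_refl numeral_2_eq_2)
  obtain n' where n': "p ^ a = 2 * n' + 1"
    using p(2) by (metis even_power oddE)
  obtain r where r: "p = 2 * r + 1" using p(2) oddE by blast
  have "2 * n + 1 = p * (2 * n' + 1)"
    using Suc.prems n' by simp
  also have "\<dots> = 2 * (r + n' * p) + 1"
    using r by (simp add: algebra_simps)
  finally have n: "n = r + n' * p" by simp
  have "(?L ^ a) ^ p = ?L ^ a"
    using p(2) Legendre_pm_1[OF h] by (cases "even a") auto
  moreover have "[(h ^ n') ^ p = (?L ^ a) ^ p] (mod int p)"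
    by (intro cong_pow Suc.IH n')
  moreover have "[h ^ r = ?L] (mod int p)"
    using euler_criterion[OF p(1) \<open>2 < p\<close>, of h] r by (simp add: cong_sym)
  ultimately show ?case
    unfolding n power_add power_mult by (simp add: cong_mult)
qed simp

text \<open>In \<open>z^p - 1 = (z - 1) * (1 + z + ... + z^(p - 1))\<close> both factors are
  divisible by \<open>p\<close>.\<close>

lemma cong_1_power_prime:
  fixes z :: int
  assumes "[z = 1] (mod int p)"
  shows "[z ^ p = 1] (mod int p ^ 2)"
proof -
  have "[(\<Sum>i<p. z ^ i) = (\<Sum>i<p. 1 ^ i)] (mod int p)"
    by (intro cong_sum cong_pow assms)
  then have "int p dvd (\<Sum>i<p. z ^ i)"
    by (simp add: cong_dvd_iff)
  then show ?thesis
    using assms unfolding cong_iff_dvd_diff power2_eq_square power_diff_1_eq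
    by (intro mult_dvd_mono)
qed

lemma power_prime_power_minus_1_cong_1:
  assumes p: "prime p" "odd p" and h: "\<not> int p dvd h"
  shows "[h ^ (p ^ a - 1) = 1] (mod int p)"
proof -
  obtain n where n: "p ^ a = 2 * n + 1" using p(2) by (metis even_power oddE)
  have "[h ^ n * h ^ n = Legendre h (int p) ^ a * Legendre h (int p) ^ a] (mod int p)"
    by (intro cong_mult power_half_prime_power_cong[OF p h n])
  moreover have "Legendre h (int p) ^ a * Legendre h (int p) ^ a = 1"
    using Legendre_power_pm_1[OF h, of a] by auto
  ultimately show ?thesis
    by (simp add: n mult_2 power_add)
qed

lemma power_prime_power_minus_1_cong:
  assumes p: "prime p" "odd p" and h: "\<not> int p dvd h" and "0 < a"
  shows "[h ^ (p ^ a - 1) = h ^ (p - 1)] (mod int p ^ 2)"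
proof -
  obtain c where a: "a = Suc c" using assms(4) gr0_implies_Suc by blast
  from cong_mult[OF cong_refl cong_1_power_prime[OF power_prime_power_minus_1_cong_1[OF p h, of c]],
      of "h ^ (p - 1)"]
  have "[h ^ (p - 1 + (p ^ c - 1) * p) = h ^ (p - 1)] (mod int p ^ 2)"
    by (simp add: power_add power_mult)
  moreover have "p - 1 + (p ^ c - 1) * p = p ^ a - 1"
    using prime_gt_0_nat[OF p(1)] by (simp add: a algebra_simps)
  ultimately show ?thesis by simp
qed

lemma pm_1_cong_imp_eq:
  fixes x y p :: int
  assumes "x \<in> {1, - 1}" "y \<in> {0, 1, - 1}" "2 < p" "[x = y] (mod p)"
  shows "x = y"
  using assms zdvd_imp_le[of p "x - y"] zdvd_imp_le[of p "y - x"]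
  by (auto simp: cong_iff_dvd_diff dvd_diff_commute)

text \<open>For \<open>b = - 1\<close> this takes the place of quadratic reciprocity.\<close>

lemma lucas_u_minus_1: "lucas_u (- 1) n = Legendre (int n) 3"
proof -
  have u: "lucas_u (- 1) (3 * k) = 0 \<and> lucas_u (- 1) (3 * k + 1) = 1 \<and> lucas_u (- 1) (3 * k + 2) = - 1" for k
    by (induction k) (auto simp: numeral_3_eq_3)
  have 0: "Legendre (int (3 * k)) 3 = 0" for k
    by (simp add: Legendre_def cong_0_iff)
  have 1: "Legendre (int (3 * k + 1)) 3 = 1" for k
  proof -
    have "[1\<^sup>2 = int (3 * k + 1)] (mod 3)" by (simp add: cong_iff_dvd_diff)
    then have "QuadRes 3 (int (3 * k + 1))" unfolding QuadRes_def by (rule exI)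
    moreover have "\<not> 3 dvd int (3 * k + 1)" by presburger
    ultimately show ?thesis unfolding Legendre_def cong_0_iff by simp
  qed
  have 2: "Legendre (int (3 * k + 2)) 3 = - 1" for k
  proof -
    have "\<not> [y\<^sup>2 = int (3 * k + 2)] (mod 3)" for y
    proof -
      have "y mod 3 = 0 \<or> y mod 3 = 1 \<or> y mod 3 = 2" by arith
      moreover have "y\<^sup>2 mod 3 = (y mod 3)\<^sup>2 mod 3" by (simp add: power_mod)
      moreover have "int (3 * k + 2) mod 3 = 2" by (simp add: mod_simps)
      ultimately show ?thesis unfolding cong_def by auto
    qed
    moreover have "\<not> 3 dvd int (3 * k + 2)" by presburger
    ultimately show ?thesis by (auto simp: Legendre_def QuadRes_def cong_0_iff)
  qed
  have "n = 3 * (n div 3) \<or> n = 3 * (n div 3) + 1 \<or> n = 3 * (n div 3) + 2" by arith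
  then show ?thesis using u 0 1 2 by metis
qed

section \<open>Passage to p-adic congruences and evaluation of the two sums\<close>

lemma padic_integral_of_int_div:
  assumes "prime p" and "\<not> int p dvd d"
  shows "padic_integral p (of_int x / of_int d)"
proof -
  obtain n e where ne: "quotient_of (of_int x / of_int d) = (n, e)" by (metis surj_pair)
  have "d \<noteq> 0" using assms(2) by auto
  moreover have "e > 0" "coprime n e" and "(of_int x / of_int d :: rat) = of_int n / of_int e"
    using quotient_of_denom_pos[OF ne] quotient_of_coprime[OF ne] quotient_of_div[OF ne] by auto
  ultimately have "x * e = n * d"
    by (simp add: frac_eq_eq flip: of_int_mult)
  then have "e dvd d"
    using \<open>coprime n e\<close> by (metis coprime_commute coprime_dvd_mult_right_iff dvd_triv_right)
  then show ?thesis
    using assms(2) unfolding padic_integral_def ne by (auto dest: dvd_trans)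
qed

lemma padic_cong_of_int_div:
  assumes "prime p" and "\<not> int p dvd d" and "[x = d * y] (mod int p ^ m)"
  shows "padic_cong p m (of_int x / of_int d) (of_int y)"
proof -
  obtain z where z: "x - d * y = int p ^ m * z"
    using assms(3) by (auto simp: cong_iff_dvd_diff)
  have d: "d \<noteq> 0" using assms(2) by auto
  then have "of_int x / of_int d - of_int y = (of_int (x - d * y) :: rat) / of_int d"
    by (simp add: field_simps)
  also have "\<dots> = of_nat p ^ m * (of_int z / of_int d)"
    unfolding z by simp
  finally have diff: "of_int x / of_int d - of_int y = of_nat p ^ m * (of_int z / of_int d :: rat)" .
  have "padic_integral p (of_int y)"
    using padic_integral_of_int_div[OF assms(1), of 1 y] assms(1) by (simp add: prime_nat_iff)
  with diff show ?thesis
    unfolding padic_cong_def by (blast intro: padic_integral_of_int_div[OF assms(1,2)])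
qed

text \<open>The case \<open>h = 2\<close>, \<open>M = 1\<close>, \<open>b = - 1\<close>,
  \<open>D = - 3\<close>: the weights \<open>2 * c k - 1\<close> give exactly
  \<open>b * A0 + 2 * A1\<close>, and \<open>\<delta> = 1\<close>.\<close>

lemma sum_choose_twice_minus_1_central_cong:
  assumes p: "prime p" "p > 3" and a: "a > 0"
  shows "[(\<Sum>k<p ^ a. int ((2 * p ^ a - 1) choose k) * int ((2 * k) choose k) * (- 1) ^ k) =
    Jacobi (int (p ^ a)) 3 * (2 * 3 ^ (p - 1) - 1)] (mod int p ^ 2)"
proof -
  let ?q = "p ^ a" and ?B = "\<lambda>k. int ((2 * k) choose k)"
  let ?c = "\<lambda>k. (- 1) ^ k * int ((?q - 1) choose k)"
  have odd: "odd p" using p prime_odd_nat by auto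
  obtain n where q: "?q = 2 * n + 1" using odd by (metis even_power oddE)
  have 3: "\<not> int p dvd 3" "\<not> int p dvd - 3"
    using p by (auto dest!: zdvd_imp_le)
  define \<epsilon> where "\<epsilon> = Legendre (- 3) (int p) ^ a"
  have \<epsilon>: "\<epsilon> \<in> {1, - 1}" "[(- 1 - 2) ^ n = \<epsilon>] (mod int p)"
    using Legendre_power_pm_1[OF 3(2)] power_half_prime_power_cong[OF p(1) odd 3(2) q]
    by (simp_all add: \<epsilon>_def)
  \<comment> \<open>Two evaluations of \<open>U * V = lucas_u (- 1) q\<close>: by signs modulo
    \<open>p\<close>, and exactly by the period 3 of the sequence.\<close>
  have "[\<epsilon> * 1 = Legendre (int ?q) 3] (mod int p)"
    using cong_mult[OF cong_trans[OF lucas_u_add_cong[OF p(1) q, of "- 1"] \<epsilon>(2)]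
        lucas_u_diff_cong[OF p(1) q, of "- 1"]]
    unfolding lucas_u_odd[symmetric] unfolding q[symmetric] lucas_u_minus_1 by (simp add: cong_sym)
  then have "\<epsilon> = Legendre (int ?q) 3"
    using \<epsilon>(1) p(2) by (intro pm_1_cong_imp_eq[of _ _ "int p"]) (auto simp: Legendre_def)
  also have "\<dots> = Jacobi (int ?q) 3"
    by (simp add: Jacobi_def prime_factorization_prime)
  finally have J: "\<epsilon> = Jacobi (int ?q) 3" .
  have "[(\<Sum>k<?q. int ((2 * ?q - 1) choose k) * ?B k * (- 1) ^ k) = (\<Sum>k<?q. (2 * ?c k - 1) * ?B k)] (mod int p ^ 2)"
  proof (rule cong_sum)
    fix k assume "k \<in> {..<?q}"
    then have "[(- 1) ^ k * int ((2 * ?q - 1) choose k) * ?B k = (2 * ?c k - 1) * ?B k] (mod int p ^ 2)"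
      by (intro cong_mult choose_twice_prime_power_minus_1_cong[OF p(1)] cong_refl) simp
    then show "[int ((2 * ?q - 1) choose k) * ?B k * (- 1) ^ k = (2 * ?c k - 1) * ?B k] (mod int p ^ 2)"
      by (simp add: mult_ac)
  qed
  also have "(\<Sum>k<?q. (2 * ?c k - 1) * ?B k) = - 1 * (\<Sum>k<?q. ?B k * (- 1 + 2) ^ (?q - 1 - k)) +
      2 * (\<Sum>k<?q. ?c k * ?B k * (- 1 + 2) ^ (?q - 1 - k))"
    by (simp add: left_diff_distrib sum_subtractf sum_distrib_left mult.assoc sum_negf)
  also have "[\<dots> = 1 * \<epsilon> * ((- 1 + 2) ^ (?q - 1) * (- 1 + 2) + 2 * ((- 1 - 2) ^ (?q - 1) - 1))] (mod int p ^ 2)"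
    by (rule combined_sum_cong[OF p(1) odd q _ _ \<epsilon>]) auto
  also have "1 * \<epsilon> * ((- 1 + 2) ^ (?q - 1) * (- 1 + 2) + 2 * ((- 1 - 2) ^ (?q - 1) - 1)) =
     \<epsilon> * (2 * 3 ^ (?q - 1) - 1)"
    using q by (simp add: uminus_power_if)
  also have "[\<dots> = \<epsilon> * (2 * 3 ^ (p - 1) - 1)] (mod int p ^ 2)"
    by (intro cong_mult cong_diff cong_refl power_prime_power_minus_1_cong[OF p(1) odd 3(1) a])
  finally show ?thesis unfolding J .
qed

text \<open>The case \<open>h = - 1\<close>, \<open>M = - 2\<close>, \<open>b = - 4\<close>,
  \<open>D = - 6\<close>, with denominators cleared by \<open>(- 2)^(q - 1)\<close>. The weights
  \<open>2 - c k\<close> give \<open>b * A0 + 2 * A1\<close> after multiplication by the unit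
  \<open>- 2\<close>.\<close>

lemma sum_choose_add_central_cong:
  assumes p: "prime p" "p > 3" and a: "a > 0"
  shows "[(\<Sum>k<p ^ a. int ((p ^ a + k) choose k) * int ((2 * k) choose k) * (- 2) ^ (p ^ a - 1 - k)) =
    (- 2) ^ (p ^ a - 1) * (Jacobi 3 (p ^ a) * (3 - 2 ^ (p - 1) - 3 ^ (p - 1)))] (mod int p ^ 2)"
proof -
  let ?q = "p ^ a" and ?B = "\<lambda>k. int ((2 * k) choose k)"
  let ?c = "\<lambda>k. (- 1) ^ k * int ((?q - 1) choose k)" and ?M = "\<lambda>k. (- 2 :: int) ^ (?q - 1 - k)"
  have odd: "odd p" using p prime_odd_nat by auto
  obtain n where q: "?q = 2 * n + 1" using odd by (metis even_power oddE)
  have prm: "prime (int p)" using p(1) by simp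
  have 3: "\<not> int p dvd 3" "\<not> int p dvd 2" "\<not> int p dvd - 2"
    using p by (auto dest!: zdvd_imp_le)
  have 6: "\<not> int p dvd - 6"
    using 3 prime_dvd_multD[OF prm, of 2 3] by auto
  define \<delta> \<epsilon> where "\<delta> = Legendre (- 2) (int p) ^ a" and "\<epsilon> = Legendre (- 6) (int p) ^ a"
  have \<delta>: "\<delta> \<in> {1, - 1}" "[(- 4 + 2) ^ n = \<delta>] (mod int p)"
    using Legendre_power_pm_1[OF 3(3)] power_half_prime_power_cong[OF p(1) odd 3(3) q]
    by (simp_all add: \<delta>_def)
  have \<epsilon>: "\<epsilon> \<in> {1, - 1}" "[(- 4 - 2) ^ n = \<epsilon>] (mod int p)"
    using Legendre_power_pm_1[OF 6] power_half_prime_power_cong[OF p(1) odd 6 q]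
    by (simp_all add: \<epsilon>_def)
  have J: "Jacobi 3 ?q = Legendre 3 (int p) ^ a"
    using p(1) by (simp add: Jacobi_def prime_factorization_prime_power)
  have L2: "(Legendre 2 (int p) ^ a)\<^sup>2 = 1"
    using Legendre_power_pm_1[OF 3(2), of a] by auto
  \<comment> \<open>The product of the bases is \<open>12 = 2^2 * 3\<close>, so only the symbol of 3
    remains.\<close>
  have "[\<delta> * \<epsilon> = (- 2) ^ n * (- 6) ^ n] (mod int p)"
    using cong_mult[OF \<delta>(2) \<epsilon>(2)] by (simp add: cong_sym)
  also have "(- 2) ^ n * (- 6) ^ n = (2 ^ n)\<^sup>2 * (3 :: int) ^ n"
    by (simp add: power2_eq_square flip: power_mult_distrib)
  also have "[\<dots> = (Legendre 2 (int p) ^ a)\<^sup>2 * Legendre 3 (int p) ^ a] (mod int p)"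
    by (intro cong_mult cong_pow power_half_prime_power_cong[OF p(1) odd _ q] 3)
  finally have \<sigma>: "\<delta> * \<epsilon> = Jacobi 3 ?q"
    unfolding L2 J using \<delta>(1) \<epsilon>(1) p(2) Legendre_power_pm_1[OF 3(1), of a]
    by (intro pm_1_cong_imp_eq[of _ _ "int p"]) auto
  let ?S = "\<Sum>k<?q. int ((?q + k) choose k) * ?B k * ?M k"
  have "[?S = (\<Sum>k<?q. (2 - ?c k) * ?B k * ?M k)] (mod int p ^ 2)"
    by (intro cong_sum cong_mult cong_refl choose_prime_power_add_cong[OF p(1)]) simp
  then have "[- 2 * ?S = - 2 * (\<Sum>k<?q. (2 - ?c k) * ?B k * ?M k)] (mod int p ^ 2)"
    by (intro cong_mult cong_refl)
  also have "- 2 * (\<Sum>k<?q. (2 - ?c k) * ?B k * ?M k) =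
     - 4 * (\<Sum>k<?q. ?B k * (- 4 + 2) ^ (?q - 1 - k)) +
      2 * (\<Sum>k<?q. ?c k * ?B k * (- 4 + 2) ^ (?q - 1 - k))"
    by (simp add: left_diff_distrib sum_subtractf sum_distrib_left mult.assoc sum.distrib sum_negf)
  also have "[\<dots> = \<delta> * \<epsilon> * ((- 4 + 2) ^ (?q - 1) * (- 4 + 2) + 2 * ((- 4 - 2) ^ (?q - 1) - 1))] (mod int p ^ 2)"
    by (rule combined_sum_cong[OF p(1) odd q \<delta> \<epsilon>])
  also have "\<delta> * \<epsilon> * ((- 4 + 2) ^ (?q - 1) * (- 4 + 2) + 2 * ((- 4 - 2) ^ (?q - 1) - 1)) =
     - 2 * (Jacobi 3 ?q * (2 ^ (?q - 1) - 2 ^ (?q - 1) * 3 ^ (?q - 1) + 1))"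
    unfolding \<sigma> using q by (simp add: uminus_power_if algebra_simps flip: power_mult_distrib)
  finally have cong: "[- 2 * ?S = - 2 * (Jacobi 3 ?q * (2 ^ (?q - 1) - 2 ^ (?q - 1) * 3 ^ (?q - 1) + 1))] (mod int p ^ 2)" .
  have "coprime (- 2) (int p ^ 2)"
    using odd by simp
  then have "[?S = Jacobi 3 ?q * (2 ^ (?q - 1) - 2 ^ (?q - 1) * 3 ^ (?q - 1) + 1)] (mod int p ^ 2)"
    using cong cong_mult_lcancel by blast
  also have "[Jacobi 3 ?q * (2 ^ (?q - 1) - 2 ^ (?q - 1) * 3 ^ (?q - 1) + 1) =
      Jacobi 3 ?q * (2 ^ (p - 1) - 2 ^ (p - 1) * 3 ^ (p - 1) + 1)] (mod int p ^ 2)"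
    by (intro cong_mult cong_diff cong_add cong_refl power_prime_power_minus_1_cong[OF p(1) odd _ a] 3)
  \<comment> \<open>A factor \<open>2^(p - 1)\<close> must be split off to match the clearing
    factor. The two brackets differ by \<open>(2^(p - 1) - 1)^2\<close>, which vanishes modulo
    \<open>p^2\<close>.\<close>
  also have "[Jacobi 3 ?q * (2 ^ (p - 1) - 2 ^ (p - 1) * 3 ^ (p - 1) + 1) =
      Jacobi 3 ?q * (2 ^ (p - 1) * (3 - 2 ^ (p - 1) - 3 ^ (p - 1)))] (mod int p ^ 2)"
  proof -
    have "[2 ^ (p - 1) = 1] (mod int p)"
      using power_prime_power_minus_1_cong_1[OF p(1) odd 3(2), of 1] by simp
    then have "int p ^ 2 dvd (2 ^ (p - 1) - 1) ^ 2"
      by (simp add: cong_iff_dvd_diff)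
    also have "(2 ^ (p - 1) - 1) ^ 2 = 2 ^ (p - 1) - 2 ^ (p - 1) * 3 ^ (p - 1) + 1 -
        2 ^ (p - 1) * (3 - 2 ^ (p - 1) - 3 ^ (p - 1) :: int)"
      by (simp add: power2_eq_square algebra_simps)
    finally show ?thesis
      by (intro cong_mult cong_refl) (simp add: cong_iff_dvd_diff)
  qed
  also have "[Jacobi 3 ?q * (2 ^ (p - 1) * (3 - 2 ^ (p - 1) - 3 ^ (p - 1))) =
      Jacobi 3 ?q * ((- 2) ^ (?q - 1) * (3 - 2 ^ (p - 1) - 3 ^ (p - 1)))] (mod int p ^ 2)"
    using power_prime_power_minus_1_cong[OF p(1) odd 3(2) a] q
    by (intro cong_mult cong_refl) (simp add: cong_sym)
  finally show ?thesis by (simp add: mult.left_commute)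
qed

theorem corollary1p2:
  fixes p a :: nat
  assumes "prime p" and "p > 3" and "a > 0"
  shows "padic_cong p 2
           (\<Sum>k = 0..p ^ a - 1.
              of_nat ((2 * p ^ a - 1) choose k) * of_nat ((2 * k) choose k) * (- 1) ^ k)
           (of_int (Jacobi (int (p ^ a)) 3) * (2 * 3 ^ (p - 1) - 1)) \<and>
         padic_cong p 2
           (\<Sum>k = 0..p ^ a - 1.
              of_nat ((p ^ a + k) choose k) * (of_nat ((2 * k) choose k) / (- 2) ^ k))
           (of_int (Jacobi 3 (p ^ a)) *
              (1 - of_nat p * (fermat_quotient p 2 + fermat_quotient p 3)))"
proof
  let ?q = "p ^ a"
  have "?q = Suc (?q - 1)"
    using prime_gt_0_nat[OF assms(1)] by simp
  then have q: "{0..?q - 1} = {..<?q}"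
    by (metis atLeast0AtMost lessThan_Suc_atMost)
  have "padic_cong p 2
     (of_int (\<Sum>k<?q. int ((2 * ?q - 1) choose k) * int ((2 * k) choose k) * (- 1) ^ k) / of_int 1)
     (of_int (Jacobi (int ?q) 3 * (2 * 3 ^ (p - 1) - 1)))"
    using sum_choose_twice_minus_1_central_cong[OF assms] not_prime_unit[of p] assms(1)
    by (intro padic_cong_of_int_div) auto
  then show "padic_cong p 2
     (\<Sum>k = 0..?q - 1. of_nat ((2 * ?q - 1) choose k) * of_nat ((2 * k) choose k) * (- 1) ^ k)
     (of_int (Jacobi (int ?q) 3) * (2 * 3 ^ (p - 1) - 1))"
    unfolding q by simp
  have two: "\<not> int p dvd (- 2) ^ (?q - 1)"
  proof
    assume "int p dvd (- 2) ^ (?q - 1)"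
    then have "int p dvd 2"
      using assms(1) prime_dvd_power[of "int p" "- 2" "?q - 1"] by simp
    then show False
      using assms(2) zdvd_imp_le by fastforce
  qed
  \<comment> \<open>The common denominator \<open>(- 2)^(q - 1)\<close> is prime to
    \<open>p\<close>, so the integer congruence divides down to the rational one.\<close>
  have div: "of_int (\<Sum>k<?q. int ((?q + k) choose k) * int ((2 * k) choose k) * (- 2) ^ (?q - 1 - k))
       / of_int ((- 2) ^ (?q - 1)) =
     (\<Sum>k<?q. of_nat ((?q + k) choose k) * (of_nat ((2 * k) choose k) / (- 2 :: rat) ^ k))"
    unfolding of_int_sum sum_divide_distrib
  proof (rule sum.cong)
    fix k assume "k \<in> {..<?q}"
    then have "(- 2 :: rat) ^ (?q - 1) = (- 2) ^ (?q - 1 - k) * (- 2) ^ k"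
      by (simp flip: power_add)
    then show "of_int (int ((?q + k) choose k) * int ((2 * k) choose k) * (- 2) ^ (?q - 1 - k)) / of_int ((- 2) ^ (?q - 1)) =
        of_nat ((?q + k) choose k) * (of_nat ((2 * k) choose k) / (- 2 :: rat) ^ k)"
      by simp
  qed simp
  have fq: "of_nat p * (fermat_quotient p 2 + fermat_quotient p 3) = 2 ^ (p - 1) + 3 ^ (p - 1) - 2"
    using assms(2) by (simp add: fermat_quotient_def field_simps)
  have "padic_cong p 2
     (of_int (\<Sum>k<?q. int ((?q + k) choose k) * int ((2 * k) choose k) * (- 2) ^ (?q - 1 - k))
       / of_int ((- 2) ^ (?q - 1)))
     (of_int (Jacobi 3 ?q * (3 - 2 ^ (p - 1) - 3 ^ (p - 1))))"
    by (rule padic_cong_of_int_div[OF assms(1) two sum_choose_add_central_cong[OF assms]])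
  then show "padic_cong p 2
     (\<Sum>k = 0..?q - 1. of_nat ((?q + k) choose k) * (of_nat ((2 * k) choose k) / (- 2) ^ k))
     (of_int (Jacobi 3 ?q) * (1 - of_nat p * (fermat_quotient p 2 + fermat_quotient p 3)))"
    unfolding q fq div by (simp add: algebra_simps)
qed

end
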